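(* Let $D$ be a Steiner triple system on $v$ points. Then $$\gamma(D)\ \le\ v-\sqrt{\frac{v}{2}}.$$
   Context: A Steiner triple system on $v$ points ($v\ge 3$) is a $(v,3,1)$-design: a collection $D$ of $3$-element subsets (blocks) of a $v$-element set $X$ of points such that every two distinct points lie together in exactly one block. The incidence graph $G_D$ is the bipartite graph whose vertex set is the disjoint union of the points and the blocks of $D$, a point $x$ being adjacent to a block $B$ if and only if $x\in B$. A set $S$ of vertices of a graph is dominating if every vertex not in $S$ has a neighbour in $S$; the domination number of a graph is the minimum cardinality of a dominating set, and $\gamma(D)$ denotes the domination number of $G_D$. *)

theory Defs
  imports Complex_Main
begin

definition steiner_triple_system :: "nat \<Rightarrow> 'a set \<Rightarrow> 'a set set \<Rightarrow> bool" where
  "steiner_triple_system v X D \<longleftrightarrow>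
     v \<ge> 3 \<and> finite X \<and> card X = v \<and>
     (\<forall>B\<in>D. B \<subseteq> X \<and> card B = 3) \<and>
     (\<forall>x\<in>X. \<forall>y\<in>X. x \<noteq> y \<longrightarrow> (\<exists>!B. B \<in> D \<and> x \<in> B \<and> y \<in> B))"

text \<open>
  A graph is given by its vertex set \<open>V\<close> and its set \<open>E\<close> of undirected edges, each edge being the
  set of its two end points.
\<close>

definition dominating_set :: "'b set \<Rightarrow> 'b set set \<Rightarrow> 'b set \<Rightarrow> bool" where
  "dominating_set V E S \<longleftrightarrow>
     S \<subseteq> V \<and> (\<forall>u\<in>V - S. \<exists>w\<in>S. {u, w} \<in> E)"

text \<open>Finiteness of \<open>S\<close> is required since \<open>card\<close> is 0 on infinite sets.\<close>

definition domination_number :: "'b set \<Rightarrow> 'b set set \<Rightarrow> nat" where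
  "domination_number V E = (LEAST n. \<exists>S. dominating_set V E S \<and> finite S \<and> card S = n)"

definition incidence_vertices :: "'a set \<Rightarrow> 'a set set \<Rightarrow> ('a + 'a set) set" where
  "incidence_vertices X D = X <+> D"

definition incidence_edges :: "'a set \<Rightarrow> 'a set set \<Rightarrow> ('a + 'a set) set set" where
  "incidence_edges X D = {{Inl x, Inr B} | x B. x \<in> X \<and> B \<in> D \<and> x \<in> B}"

definition design_domination_number :: "'a set \<Rightarrow> 'a set set \<Rightarrow> nat" where
  "design_domination_number X D =
     domination_number (incidence_vertices X D) (incidence_edges X D)"

end

theory Submission
  imports Defs "HOL-Library.Disjoint_Sets"
begin

text \<open>
  Fix a set \<open>T\<close> of points and a family \<open>\<B>\<close> of blocks that covers \<open>T\<close> and contains every block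
  inside \<open>T\<close>. The points outside \<open>T\<close> together with \<open>\<B>\<close> dominate the incidence graph: a point of
  \<open>T\<close> lies on a block of \<open>\<B>\<close>, and a block that is not in \<open>\<B>\<close> has a point outside \<open>T\<close>. So
  \<open>\<gamma>(D) \<le> v - (|T| - |\<B>|)\<close>, and it suffices to find \<open>T\<close> and \<open>\<B>\<close> whose saving \<open>|T| - |\<B>|\<close> is
  at least \<open>\<surd>(v/2)\<close>.

  There are two ways to save. If \<open>T\<close> is the union of \<open>k\<close> disjoint blocks and contains no further
  block, these \<open>k\<close> blocks serve as \<open>\<B>\<close> and the saving is \<open>2k\<close>. If \<open>T\<close> is a set of \<open>w\<close> points
  that contains no block at all, the points can be covered in pairs and the saving is
  \<open>\<lfloor>w/2\<rfloor>\<close>.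

  Take a maximal family of \<open>k\<close> blocks of the first kind, with union \<open>U\<close>. If \<open>8k\<^sup>2 \<ge> v\<close>, the
  saving \<open>2k\<close> is large enough. Otherwise \<open>k\<close> is small, and few points are spanned by \<open>U\<close>, i.e.
  complete two points of \<open>U\<close> to a block: at most \<open>3k choose 2\<close>, which is less than \<open>9v/16\<close>. These
  include the points of \<open>U\<close>. The points that are not spanned contain no block, because such a block
  could be added to the family; so they are a large set of the second kind.
\<close>

section \<open>Blocks of a Steiner triple system\<close>

lemma block_through:
  assumes "steiner_triple_system v X D" "x \<in> X" "y \<in> X" "x \<noteq> y"
  obtains B where "B \<in> D" "x \<in> B" "y \<in> B"
  using assms unfolding steiner_triple_system_def by meson

lemma block_unique:
  assumes "steiner_triple_system v X D" "A \<in> D" "B \<in> D" "x \<noteq> y" "x \<in> A" "y \<in> A" "x \<in> B" "y \<in> B"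
  shows "A = B"
proof -
  have "x \<in> X" "y \<in> X"
    using assms unfolding steiner_triple_system_def by blast+
  then show ?thesis
    using assms unfolding steiner_triple_system_def by metis
qed

lemma finite_blocks:
  assumes "steiner_triple_system v X D"
  shows "finite D"
proof -
  have "D \<subseteq> Pow X" "finite X"
    using assms unfolding steiner_triple_system_def by auto
  then show ?thesis
    by (meson finite_Pow_iff finite_subset)
qed

text \<open>Greedy pairing: each block takes care of two points; a point left over at the end costs a
  block of its own, whence the summand \<open>1\<close>.\<close>

lemma cover_by_blocks:
  assumes S: "steiner_triple_system v X D" and "W \<subseteq> X"
  shows "\<exists>\<B>\<subseteq>D. W \<subseteq> \<Union>\<B> \<and> 2 * card \<B> \<le> card W + 1"
  using \<open>W \<subseteq> X\<close>
proof (induction "card W" arbitrary: W rule: less_induct)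
  case less
  have fin: "finite X" and card3: "card X \<ge> 3"
    using S unfolding steiner_triple_system_def by auto
  have finW: "finite W"
    using less.prems fin finite_subset by blast
  consider "W = {}" | x where "W = {x}" | x y where "x \<in> W" "y \<in> W" "x \<noteq> y"
    by blast
  then show ?case
  proof cases
    case 1
    then show ?thesis
      by (intro exI[of _ "{}"]) auto
  next
    case (2 x)
    have "X \<noteq> {x}"
      using card3 by auto
    then obtain y where "y \<in> X" "x \<noteq> y"
      using 2 less.prems by auto
    then obtain B where "B \<in> D" "x \<in> B"
      using block_through[OF S, of x y] 2 less.prems by blast
    then show ?thesis
      using 2 by (intro exI[of _ "{B}"]) auto
  next
    case (3 x y)
    then obtain B where B: "B \<in> D" "x \<in> B" "y \<in> B"
      using block_through[OF S, of x y] less.prems by blast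
    have cW: "card W = card (W - {x, y}) + 2"
      using 3 finW card_Diff_subset[of "{x,y}" W] card_mono[of W "{x,y}"] by auto
    obtain \<B> where \<B>: "\<B> \<subseteq> D" "W - {x, y} \<subseteq> \<Union>\<B>" "2 * card \<B> \<le> card (W - {x, y}) + 1"
      using less.hyps[of "W - {x, y}"] less.prems cW by force
    have "card (insert B \<B>) \<le> card \<B> + 1"
      by (simp add: card_insert_le_m1 card_insert_if finite_subset[OF \<B>(1) finite_blocks[OF S]])
    then have "2 * card (insert B \<B>) \<le> card W + 1"
      using \<B> cW by linarith
    moreover have "W \<subseteq> \<Union>(insert B \<B>)"
      using \<B> B by auto
    ultimately show ?thesis
      using \<B> B by (intro exI[of _ "insert B \<B>"]) auto
  qed
qed

section \<open>Dominating sets from a set of points and a family of blocks\<close>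

lemma domination_number_le:
  assumes "dominating_set V E S" "finite S"
  shows "domination_number V E \<le> card S"
  unfolding domination_number_def using assms by (intro Least_le) blast

lemma design_domination_number_saving:
  assumes S: "steiner_triple_system v X D" and T: "T \<subseteq> X" and \<B>: "\<B> \<subseteq> D"
    and cover: "T \<subseteq> \<Union>\<B>" and inside: "\<And>B. B \<in> D \<Longrightarrow> B \<subseteq> T \<Longrightarrow> B \<in> \<B>"
  shows "design_domination_number X D + card T \<le> v + card \<B>"
proof -
  let ?S = "Inl ` (X - T) \<union> Inr ` \<B> :: ('a + 'a set) set"
  have fin: "finite X" "card X = v" and sub: "\<And>B. B \<in> D \<Longrightarrow> B \<subseteq> X"
    using S unfolding steiner_triple_system_def by auto
  have fin\<B>: "finite \<B>"
    using \<B> finite_blocks[OF S] finite_subset by blast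
  have "\<exists>w\<in>?S. {u, w} \<in> incidence_edges X D"
    if u: "u \<in> incidence_vertices X D - ?S" for u
  proof (cases u)
    case (Inl x)
    then have "x \<in> T"
      using u unfolding incidence_vertices_def by auto
    then obtain B where "B \<in> \<B>" "x \<in> B"
      using cover by blast
    then have "{u, Inr B} \<in> incidence_edges X D"
      using Inl \<B> \<open>x \<in> T\<close> T unfolding incidence_edges_def by blast
    then show ?thesis
      using \<open>B \<in> \<B>\<close> by blast
  next
    case (Inr B)
    then have "B \<in> D" "B \<notin> \<B>"
      using u unfolding incidence_vertices_def by auto
    then obtain x where x: "x \<in> B" "x \<notin> T"
      using inside by blast
    then have "{u, Inl x} \<in> incidence_edges X D"
      using Inr \<open>B \<in> D\<close> sub unfolding incidence_edges_def by blast
    then show ?thesis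
      using x sub \<open>B \<in> D\<close> by blast
  qed
  then have "dominating_set (incidence_vertices X D) (incidence_edges X D) ?S"
    using \<B> unfolding dominating_set_def incidence_vertices_def by auto
  then have "design_domination_number X D \<le> card ?S"
    unfolding design_domination_number_def
    using fin fin\<B> by (intro domination_number_le) auto
  also have "\<dots> \<le> card (X - T) + card \<B>"
    by (metis (no_types, lifting) card_Un_le card_image inj_Inl inj_Inr inj_on_subset subset_UNIV)
  also have "card (X - T) = v - card T"
    using fin T by (simp add: card_Diff_subset finite_subset)
  finally show ?thesis
    using card_mono[OF fin(1) T] fin(2) by linarith
qed

section \<open>Packings that induce no further block\<close>

definition induced_packing :: "'a set set \<Rightarrow> 'a set set \<Rightarrow> bool" where
  "induced_packing D P \<longleftrightarrow> P \<subseteq> D \<and> disjoint P \<and> (\<forall>B\<in>D. B \<subseteq> \<Union>P \<longrightarrow> B \<in> P)"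

definition spanned :: "'a set set \<Rightarrow> 'a set \<Rightarrow> 'a set" where
  "spanned D U = {x. \<exists>e\<subseteq>U. card e = 2 \<and> x \<notin> e \<and> insert x e \<in> D}"

text \<open>Two points lie on one block, so they span one further point.\<close>

lemma card_spanned_le:
  assumes S: "steiner_triple_system v X D" and "U \<subseteq> X"
  shows "finite (spanned D U)" "card (spanned D U) \<le> card U choose 2"
proof -
  let ?E = "{e. e \<subseteq> U \<and> card e = 2}"
  have fin: "finite U"
    using S finite_subset[OF \<open>U \<subseteq> X\<close>] unfolding steiner_triple_system_def by simp
  have uniq: "x = y"
    if e: "card e = 2" and x: "x \<notin> e" "insert x e \<in> D" and y: "y \<notin> e" "insert y e \<in> D" for e x y
  proof -
    obtain a b where "e = {a, b}" "a \<noteq> b"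
      using e by (meson card_2_iff)
    then have "insert x e = insert y e"
      using block_unique[OF S x(2) y(2), of a b] by auto
    then show ?thesis
      using x y by blast
  qed
  have sub: "spanned D U \<subseteq> (\<lambda>e. THE x. x \<notin> e \<and> insert x e \<in> D) ` ?E"
  proof
    fix x assume "x \<in> spanned D U"
    then obtain e where e: "e \<subseteq> U" "card e = 2" "x \<notin> e" "insert x e \<in> D"
      unfolding spanned_def by blast
    then have "(THE x. x \<notin> e \<and> insert x e \<in> D) = x"
      using uniq by (intro the_equality) auto
    then show "x \<in> (\<lambda>e. THE x. x \<notin> e \<and> insert x e \<in> D) ` ?E"
      using e by force
  qed
  have E: "finite ?E" "card ?E = card U choose 2"
    using fin n_subsets by auto
  show "finite (spanned D U)"
    using sub E(1) by (rule finite_surj[rotated])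
  show "card (spanned D U) \<le> card U choose 2"
    using surj_card_le[OF E(1) sub] E(2) by simp
qed

text \<open>A point of a block in \<open>P\<close> is spanned by the other two points of that block. This is why the
  bound \<open>3k choose 2\<close> on the spanned points already accounts for the points of the packing.\<close>

lemma packing_subset_spanned:
  assumes S: "steiner_triple_system v X D" and "P \<subseteq> D"
  shows "\<Union>P \<subseteq> spanned D (\<Union>P)"
proof
  fix x assume "x \<in> \<Union>P"
  then obtain B where B: "B \<in> P" "x \<in> B"
    by blast
  have "card B = 3"
    using B \<open>P \<subseteq> D\<close> S unfolding steiner_triple_system_def by blast
  then have "card (B - {x}) = 2" "insert x (B - {x}) = B"
    using B by auto
  then show "x \<in> spanned D (\<Union>P)"
    using B \<open>P \<subseteq> D\<close> unfolding spanned_def by (intro CollectI exI[of _ "B - {x}"]) auto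
qed

text \<open>A block \<open>B\<close> of points that are not spanned enlarges the packing. For suppose that another block
  \<open>A\<close> lies in \<open>\<Union>P \<union> B\<close> but not in \<open>\<Union>P\<close>. It meets \<open>B\<close> in a single point, and this point is spanned
  by the other two points of \<open>A\<close>, which lie in \<open>\<Union>P\<close>.\<close>

lemma induced_packing_insert:
  assumes S: "steiner_triple_system v X D" and P: "induced_packing D P"
    and B: "B \<in> D" "B \<inter> spanned D (\<Union>P) = {}"
  shows "induced_packing D (insert B P)"
proof -
  have PD: "P \<subseteq> D"
    using P unfolding induced_packing_def by blast
  have BU: "B \<inter> \<Union>P = {}"
    using packing_subset_spanned[OF S PD] B by blast
  have "A \<in> insert B P" if A: "A \<in> D" "A \<subseteq> \<Union>(insert B P)" for A
  proof (rule ccontr)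
    assume notin: "A \<notin> insert B P"
    then have "\<not> A \<subseteq> \<Union>P"
      using P A unfolding induced_packing_def by blast
    then obtain x where x: "x \<in> A" "x \<in> B"
      using A by blast
    have "A - {x} \<subseteq> \<Union>P"
    proof
      fix y assume y: "y \<in> A - {x}"
      then have "y \<notin> B"
        using block_unique[OF S A(1) B(1), of x y] x notin by blast
      then show "y \<in> \<Union>P"
        using y A by blast
    qed
    moreover have "card A = 3"
      using A S unfolding steiner_triple_system_def by blast
    then have "card (A - {x}) = 2" "insert x (A - {x}) = A"
      using x by auto
    ultimately have "x \<in> spanned D (\<Union>P)"
      using A unfolding spanned_def by (intro CollectI exI[of _ "A - {x}"]) auto
    then show False
      using x B by blast
  qed
  moreover have "disjoint (insert B P)"
    using P BU unfolding induced_packing_def disjoint_def by blast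
  ultimately show ?thesis
    using PD B unfolding induced_packing_def by blast
qed

lemma card_Union_packing:
  assumes S: "steiner_triple_system v X D" and P: "induced_packing D P"
  shows "card (\<Union>P) = 3 * card P"
proof -
  have "card B = 3" if "B \<in> P" for B
    using that P S unfolding induced_packing_def steiner_triple_system_def by blast
  moreover from this have "finite B" if "B \<in> P" for B
    using that by (metis card.infinite zero_neq_numeral)
  ultimately show ?thesis
    using P card_Union_disjoint[of P] unfolding induced_packing_def by simp
qed

text \<open>A maximal packing is nonempty: the empty family spans no point, and so leaves every block free.\<close>

lemma ex_maximal_induced_packing:
  assumes S: "steiner_triple_system v X D"
  obtains P where "induced_packing D P" "P \<noteq> {}" "\<And>B. B \<in> D \<Longrightarrow> \<not> B \<subseteq> X - spanned D (\<Union>P)"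
proof -
  have block: "B \<noteq> {}" if "B \<in> D" for B
    using that S unfolding steiner_triple_system_def by fastforce
  have "finite {P. induced_packing D P}"
    by (rule finite_subset[of _ "Pow D"]) (auto simp: induced_packing_def finite_blocks[OF S])
  moreover have "induced_packing D {}"
    using block unfolding induced_packing_def disjoint_def by auto
  ultimately obtain P where P: "induced_packing D P"
    and max: "\<And>Q. induced_packing D Q \<Longrightarrow> P \<subseteq> Q \<Longrightarrow> P = Q"
    using finite_has_maximal[of "{P. induced_packing D P}"] by auto
  have free: "\<not> B \<subseteq> X - spanned D (\<Union>P)" if B: "B \<in> D" for B
  proof
    assume sub: "B \<subseteq> X - spanned D (\<Union>P)"
    then have "induced_packing D (insert B P)"
      by (intro induced_packing_insert[OF S P B]) blast
    then have "B \<in> P"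
      using max by blast
    then have "B \<subseteq> spanned D (\<Union>P)"
      using packing_subset_spanned[OF S] P unfolding induced_packing_def by blast
    then show False
      using sub block[OF B] by blast
  qed
  have "P \<noteq> {}"
  proof
    assume "P = {}"
    then have "spanned D (\<Union>P) = {}"
      unfolding spanned_def by auto
    moreover obtain B where "B \<in> D"
    proof -
      have "\<exists>x\<in>X. \<exists>y\<in>X. x \<noteq> y"
        using S card_le_Suc0_iff_eq[of X] unfolding steiner_triple_system_def by force
      then show ?thesis
        using that block_through[OF S] by blast
    qed
    moreover have "B \<subseteq> X"
      using \<open>B \<in> D\<close> S unfolding steiner_triple_system_def by blast
    ultimately show False
      using free by blast
  qed
  then show ?thesis
    using that P free by blast
qed

section \<open>The bound\<close>

text \<open>The two savings meet here: when \<open>2k\<close> is too small for the bound, \<open>\<lfloor>w/2\<rfloor>\<close> is large enough.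
  Here \<open>w \<ge> v - (3k choose 2) = v - (9k\<^sup>2 - 3k)/2\<close>, so \<open>16(w - 1) \<ge> 7v + 8\<close> by \<open>8k\<^sup>2 < v\<close> and
  \<open>k \<ge> 1\<close>, and \<open>(7v + 8)\<^sup>2 \<ge> 512v\<close> holds as soon as \<open>v \<ge> 8\<close>,
  which \<open>8k\<^sup>2 < v\<close> ensures.\<close>

lemma pairing_saving_suffices:
  fixes v k w :: nat
  assumes k: "1 \<le> k" "8 * k\<^sup>2 < v" and w: "v \<le> w + (3 * k choose 2)"
  shows "v \<le> 2 * (w div 2)\<^sup>2"
proof -
  have "2 * (3 * k choose 2) + 3 * k = 9 * k\<^sup>2"
  proof -
    have "even (3 * k * (3 * k - 1))"
      by (cases "even k") auto
    then have "2 * (3 * k choose 2) = 3 * k * (3 * k - 1)"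
      unfolding choose_two by (rule dvd_mult_div_cancel)
    then show ?thesis
      using k(1) by (cases k) (auto simp: power2_eq_square algebra_simps)
  qed
  then have "16 * w \<ge> 7 * v + 24"
    using k w by linarith
  then have g: "32 * (w div 2) \<ge> 7 * v + 8"
    by linarith
  have "1\<^sup>2 \<le> k\<^sup>2"
    using k(1) by (rule power_mono) simp
  then have v: "v \<ge> 9"
    using k(2) by simp
  have "512 * v \<le> (7 * v + 8)\<^sup>2"
  proof -
    have "9 * v \<le> v * v"
      using v by simp
    moreover have "(7 * v + 8)\<^sup>2 = 49 * (v * v) + 112 * v + 64"
      by (simp add: power2_eq_square algebra_simps)
    ultimately show ?thesis
      using v by linarith
  qed
  also have "\<dots> \<le> (32 * (w div 2))\<^sup>2"
    using g by (intro power_mono) auto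
  finally show ?thesis
    by (simp add: power_mult_distrib)
qed

theorem theorem7p6:
  fixes v :: nat and X :: "'a set" and D :: "'a set set"
  assumes "steiner_triple_system v X D"
  shows "real (design_domination_number X D) \<le> real v - sqrt (real v / 2)"
proof -
  note S = assms
  have fin: "finite X" "card X = v" and sub: "\<And>B. B \<in> D \<Longrightarrow> B \<subseteq> X"
    using S unfolding steiner_triple_system_def by auto
  obtain P where P: "induced_packing D P" "P \<noteq> {}"
    and free: "\<And>B. B \<in> D \<Longrightarrow> \<not> B \<subseteq> X - spanned D (\<Union>P)"
    using ex_maximal_induced_packing[OF S] by blast
  have PD: "P \<subseteq> D" and UX: "\<Union>P \<subseteq> X"
    using P(1) sub unfolding induced_packing_def by blast+
  define k where "k = card P"
  have cardU: "card (\<Union>P) = 3 * k"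
    using card_Union_packing[OF S P(1)] k_def by simp
  have "\<exists>g. design_domination_number X D + g \<le> v \<and> v \<le> 2 * g\<^sup>2"
  proof (cases "v \<le> 8 * k\<^sup>2")
    case True
    have "design_domination_number X D + card (\<Union>P) \<le> v + card P"
      using P(1) by (intro design_domination_number_saving[OF S UX PD])
        (auto simp: induced_packing_def)
    then have "design_domination_number X D + 2 * k \<le> v"
      using cardU k_def by linarith
    then show ?thesis
      using True by (intro exI[of _ "2 * k"]) (auto simp: power_mult_distrib)
  next
    case False
    define W where "W = X - spanned D (\<Union>P)"
    have "v \<le> card W + (3 * k choose 2)"
      using card_spanned_le[OF S UX] diff_card_le_card_Diff[of "spanned D (\<Union>P)" X] fin cardU
      unfolding W_def by simp
    moreover have "1 \<le> k"
      using P(2) finite_subset[OF PD finite_blocks[OF S]] unfolding k_def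
      by (simp add: Suc_leI card_gt_0_iff)
    ultimately have large: "v \<le> 2 * (card W div 2)\<^sup>2"
      using False pairing_saving_suffices by simp
    have "W \<subseteq> X"
      unfolding W_def by blast
    then obtain \<B> where \<B>: "\<B> \<subseteq> D" "W \<subseteq> \<Union>\<B>" "2 * card \<B> \<le> card W + 1"
      using cover_by_blocks[OF S \<open>W \<subseteq> X\<close>] by metis
    have "design_domination_number X D + card W \<le> v + card \<B>"
      using free unfolding W_def[symmetric]
      by (intro design_domination_number_saving[OF S \<open>W \<subseteq> X\<close> \<B>(1,2)]) blast
    then have "design_domination_number X D + card W div 2 \<le> v"
      using \<B>(3) by linarith
    then show ?thesis
      using large by blast
  qed
  then obtain g where g: "design_domination_number X D + g \<le> v" "v \<le> 2 * g\<^sup>2"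
    by blast
  have "real v \<le> 2 * (real g)\<^sup>2"
    using g(2) by (metis of_nat_le_iff of_nat_mult of_nat_numeral of_nat_power)
  then have "sqrt (real v / 2) \<le> real g"
    by (intro real_le_lsqrt) auto
  then show ?thesis
    using g(1) by linarith
qed

end
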